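(* Let $A\in\mathbb{R}^{n\times n}$ be totally positive and let $s=(1,-1,1,-1,\dots)^T\in\mathbb{R}^n$. Then $$r(A)=\frac{1}{s^TA^{-1}s}.$$
   Context: A matrix $A\in\mathbb{R}^{n\times n}$ is totally positive if all its minors are (strictly) positive. The regularity radius of $A$ is $r(A)=\min\{\delta\ge 0 : [A-\delta ee^T,A+\delta ee^T]\text{ is singular}\}$, where $e=(1,\dots,1)^T$, $[A-\delta ee^T,A+\delta ee^T]$ is the set of all real matrices $A'$ with $A-\delta ee^T\le A'\le A+\delta ee^T$ entrywise, and this set is called singular if it contains at least one singular matrix. *)

theory Defs
  imports
    "Jordan_Normal_Form.Determinant"
    "Jordan_Normal_Form.Gauss_Jordan_Elimination"
    "Jordan_Normal_Form.DL_Submatrix"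
begin

definition totally_positive :: "real mat \<Rightarrow> bool" where
  "totally_positive A \<longleftrightarrow> square_mat A \<and>
     (\<forall>I J. I \<subseteq> {..<dim_row A} \<and> J \<subseteq> {..<dim_col A} \<and> I \<noteq> {} \<and> card I = card J
        \<longrightarrow> det (submatrix A I J) > 0)"

definition singular_set :: "real mat set \<Rightarrow> bool" where
  "singular_set S \<longleftrightarrow> (\<exists>M\<in>S. \<not> invertible_mat M)"

(* e e^T with e = (1,...,1)^T of length n *)
definition ones_mat :: "nat \<Rightarrow> real mat" where
  "ones_mat n = mat n n (\<lambda>_. 1)"

(* The library order on matrices is entrywise and forces equal dimensions, so the set interval
   {L..U} is the interval matrix [L, U].  LEAST on the reals denotes an attained minimum (not an
   infimum) and is unspecified if there is none. *)
definition regularity_radius :: "real mat \<Rightarrow> real" where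
  "regularity_radius A = (LEAST \<delta>. \<delta> \<ge> 0 \<and>
     singular_set {A - \<delta> \<cdot>\<^sub>m ones_mat (dim_row A) .. A + \<delta> \<cdot>\<^sub>m ones_mat (dim_row A)})"

(* (1,-1,1,-1,...)^T; vectors are indexed from 0 *)
definition sign_vec :: "nat \<Rightarrow> real vec" where
  "sign_vec n = vec n (\<lambda>i. (-1) ^ i)"

end

(* The inverse of a totally positive matrix A has the checkerboard sign pattern, by the cofactor
   formula, so s^T A^{-1} s is the sum of the absolute values of all entries of A^{-1}; call it S.
   If A' x = 0 with x nonzero and A' is within \<delta> of A entrywise, then x = A^{-1} (A - A') x yields
   |x|_1 \<le> \<delta> S |x|_1, hence \<delta> \<ge> 1/S. The bound is attained by A - s s^T / S, which kills A^{-1} s. *)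
theory Submission imports Defs
begin

section \<open>Submatrices keeping all indices or dropping one row and one column\<close>

lemma pick_lessThan:
  assumes "i < n"
  shows "pick {..<n} i = i"
proof -
  \<comment> \<open>\<open>pick\<close> finds a member of a set from the number of members below it,
    so everything reduces to counting those.\<close>
  have "{a \<in> {..<n}. a < i} = {..<i}"
    using assms by auto
  then show ?thesis
    using pick_card_in_set[of i "{..<n}"] assms by simp
qed

lemma pick_lessThan_remove:
  assumes "k < n" "i < n - 1"
  shows "pick ({..<n} - {k}) i = (if i < k then i else Suc i)"
proof (cases "i < k")
  case True
  have "{a \<in> {..<n} - {k}. a < i} = {..<i}"
    using True assms by auto
  then show ?thesis
    using pick_card_in_set[of i "{..<n} - {k}"] True assms by simp
next
  case False
  \<comment> \<open>Here \<open>k \<le> i\<close>, so the gap lies below \<open>Suc i\<close> and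
    exactly \<open>i\<close> members remain below it.\<close>
  have "{a \<in> {..<n} - {k}. a < Suc i} = {..<Suc i} - {k}"
    using False assms by auto
  moreover have "card ({..<Suc i} - {k}) = i"
    using False by simp
  ultimately show ?thesis
    using pick_card_in_set[of "Suc i" "{..<n} - {k}"] False assms by simp
qed

lemma submatrix_lessThan:
  assumes "A \<in> carrier_mat n m"
  shows "submatrix A {..<n} {..<m} = A"
  using assms by (intro eq_matI) (auto simp: submatrix_def pick_lessThan)

text \<open>Total positivity speaks of \<open>submatrix\<close>, cofactors of
  \<open>mat_delete\<close>; this is the bridge between them.\<close>

lemma submatrix_remove:
  assumes A: "A \<in> carrier_mat n m" and k: "k < n" and l: "l < m"
  shows "submatrix A ({..<n} - {k}) ({..<m} - {l}) = mat_delete A k l"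
proof -
  have *: "{i. i < p \<and> i \<in> {..<p} - {q}} = {..<p} - {q}" for p q :: nat
    by auto
  have c: "card ({..<p} - {q}) = p - 1" if "q < p" for p q :: nat
    using that by simp
  show ?thesis
    using assms
    by (intro eq_matI) (auto simp: submatrix_def mat_delete_def * c pick_lessThan_remove
        simp del: Diff_iff card_Diff_insert)
qed

section \<open>Sign pattern of the inverse of a totally positive matrix\<close>

lemma totally_positive_det_pos:
  assumes "A \<in> carrier_mat n n" "totally_positive A" "n \<ge> 1"
  shows "det A > 0"
proof -
  have "{..<n} \<noteq> {}"
    using assms(3) by (simp add: lessThan_empty_iff)
  then have "det (submatrix A {..<n} {..<n}) > 0"
    using assms(1,2) unfolding totally_positive_def by auto
  then show ?thesis
    by (simp add: submatrix_lessThan[OF assms(1)])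
qed

lemma totally_positive_det_mat_delete_pos:
  assumes A: "A \<in> carrier_mat n n" and tp: "totally_positive A" and "k < n" "l < n"
  shows "det (mat_delete A k l) > 0"
\<comment> \<open>For \<open>n = 1\<close> no index remains, and \<open>totally_positive\<close>
  covers only nonempty index sets; the empty determinant is 1.\<close>
proof (cases "n = 1")
  case True
  then have "mat_delete A k l \<in> carrier_mat 0 0"
    using mat_delete_carrier[OF A] by simp
  then show ?thesis
    by simp
next
  case False
  then have "card ({..<n} - {k}) > 0"
    using assms(3) by simp
  then have "{..<n} - {k} \<noteq> {}"
    by (metis card.empty less_numeral_extra(3))
  moreover have "card ({..<n} - {k}) = card ({..<n} - {l})"
    using assms(3,4) by simp
  ultimately have "det (submatrix A ({..<n} - {k}) ({..<n} - {l})) > 0"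
    using A tp unfolding totally_positive_def by (metis Diff_subset carrier_matD)
  then show ?thesis
    by (simp add: submatrix_remove[OF A assms(3,4)])
qed

text \<open>Cramer's rule without division: multiply the identity for \<open>A * adj_mat A\<close>
  by \<open>B\<close> on the left.\<close>

lemma inverse_eq_adj_mat:
  fixes A :: "'a :: field mat"
  assumes A: "A \<in> carrier_mat n n" and B: "B \<in> carrier_mat n n" and BA: "B * A = 1\<^sub>m n"
  shows "adj_mat A = det A \<cdot>\<^sub>m B"
proof -
  have "adj_mat A = (B * A) * adj_mat A"
    using adj_mat(1)[OF A] BA by simp
  also have "\<dots> = B * (A * adj_mat A)"
    using A B adj_mat(1)[OF A] by (intro assoc_mult_mat) auto
  also have "\<dots> = det A \<cdot>\<^sub>m B"
    using B by (simp add: adj_mat(2)[OF A] mult_smult_distrib[of _ n n _ n])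
  finally show ?thesis .
qed

text \<open>Up to the factor \<open>det A\<close>, an entry of the inverse is a signed minor of
  order \<open>n - 1\<close>. The cofactor sign cancels against the factor in front, and both the
  minor and \<open>det A\<close> are positive.\<close>

lemma totally_positive_inverse_checkerboard:
  assumes A: "A \<in> carrier_mat n n" and tp: "totally_positive A"
    and B: "B \<in> carrier_mat n n" and BA: "B * A = 1\<^sub>m n" and ij: "i < n" "j < n"
  shows "(-1) ^ (i + j) * B $$ (i, j) > 0"
proof -
  \<comment> \<open>The adjugate is the transposed cofactor matrix, hence the swapped
    indices.\<close>
  have "det A * B $$ (i, j) = cofactor A j i"
    using arg_cong[OF inverse_eq_adj_mat[OF A B BA], of "\<lambda>M. M $$ (i, j)"] A B ij
    by (simp add: adj_mat_def)
  then have "det A * ((-1) ^ (i + j) * B $$ (i, j)) = (-1) ^ (i + j) * cofactor A j i"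
    by (simp only: mult.left_commute[of "det A"])
  also have "\<dots> = det (mat_delete A j i)"
    unfolding cofactor_def by (simp only: add.commute[of j i] left_minus_one_mult_self)
  finally have "det A * ((-1) ^ (i + j) * B $$ (i, j)) > 0"
    using totally_positive_det_mat_delete_pos[OF A tp ij(2,1)] by simp
  moreover have "det A > 0"
    using totally_positive_det_pos[OF A tp] ij by simp
  ultimately show ?thesis
    by (rule zero_less_mult_pos)
qed

section \<open>Distance from an invertible matrix to singular ones\<close>

lemma singular_iff_kernel:
  fixes M :: "'a :: field mat"
  assumes M: "M \<in> carrier_mat n n"
  shows "\<not> invertible_mat M \<longleftrightarrow>
    (\<exists>v. v \<in> carrier_vec n \<and> v \<noteq> 0\<^sub>v n \<and> M *\<^sub>v v = 0\<^sub>v n)"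
proof -
  have "invertible_mat M \<longleftrightarrow> det M \<noteq> 0"
  proof
    assume "invertible_mat M"
    then obtain B where "M * B = 1\<^sub>m n" "B * M = 1\<^sub>m (dim_row B)"
      using M by (auto simp: invertible_mat_def inverts_mat_def)
    \<comment> \<open>\<open>inverts_mat\<close> does not state the shape of \<open>B\<close>; it is
      read off from the dimensions of the two products.\<close>
    moreover from this have "B \<in> carrier_mat n n"
      using M by (metis carrier_matD carrier_matI index_mult_mat(2,3) index_one_mat(2,3))
    ultimately have "det M * det B = 1"
      using det_mult[OF M] by (metis det_one)
    then show "det M \<noteq> 0"
      by auto
  next
    assume "det M \<noteq> 0"
    then have "M \<in> Units (ring_mat TYPE('a) n ())"
      using det_non_zero_imp_unit[OF M, of "()"] by blast
    then show "invertible_mat M"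
      using M by (auto simp: Units_def ring_mat_def invertible_mat_def inverts_mat_def)
  qed
  then show ?thesis
    using det_0_iff_vec_prod_zero_field[OF M] by blast
qed

lemma mult_mat_vec_index_sum:
  assumes "A \<in> carrier_mat m n" "x \<in> carrier_vec n" "i < m"
  shows "(A *\<^sub>v x) $ i = (\<Sum>j<n. A $$ (i, j) * x $ j)"
  using assms by (simp add: scalar_prod_def lessThan_atLeast0)

text \<open>The entrywise bound passes from the 1-norm of a kernel vector \<open>x\<close> to the
  maximum norm of \<open>A *\<^sub>v x\<close>; applying \<open>B\<close> leads back to the 1-norm
  of \<open>x\<close>. The second passage costs the sum of all absolute entries of
  \<open>B\<close>.\<close>

lemma singular_perturbation_lower_bound:
  fixes A :: "real mat"
  assumes A: "A \<in> carrier_mat n n" and B: "B \<in> carrier_mat n n" and BA: "B * A = 1\<^sub>m n"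
    and M: "M \<in> carrier_mat n n" and sing: "\<not> invertible_mat M"
    and near: "\<And>i j. i < n \<Longrightarrow> j < n \<Longrightarrow> \<bar>A $$ (i, j) - M $$ (i, j)\<bar> \<le> \<delta>"
  shows "1 \<le> \<delta> * (\<Sum>i<n. \<Sum>j<n. \<bar>B $$ (i, j)\<bar>)"
proof -
  obtain x where x: "x \<in> carrier_vec n" "x \<noteq> 0\<^sub>v n" "M *\<^sub>v x = 0\<^sub>v n"
    using sing singular_iff_kernel[OF M] by blast
  \<comment> \<open>As \<open>M *\<^sub>v x\<close> vanishes, \<open>y\<close> is also the image of
    \<open>x\<close> under the small matrix \<open>A - M\<close>.\<close>
  define y where "y = A *\<^sub>v x"
  define N where "N = (\<Sum>j<n. \<bar>x $ j\<bar>)"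
  have y_bound: "\<bar>y $ i\<bar> \<le> \<delta> * N" if i: "i < n" for i
  proof -
    have "(M *\<^sub>v x) $ i = 0"
      using x i by simp
    then have "y $ i = y $ i - (M *\<^sub>v x) $ i"
      by simp
    also have "\<dots> = (\<Sum>j<n. (A $$ (i, j) - M $$ (i, j)) * x $ j)"
      by (simp only: y_def mult_mat_vec_index_sum[OF A x(1) i] mult_mat_vec_index_sum[OF M x(1) i]
          sum_subtractf left_diff_distrib)
    also have "\<bar>\<dots>\<bar> \<le> (\<Sum>j<n. \<delta> * \<bar>x $ j\<bar>)"
      using near[OF i]
      by (intro order_trans[OF sum_abs] sum_mono) (auto simp: abs_mult intro!: mult_right_mono)
    also have "\<dots> = \<delta> * N"
      by (simp add: N_def sum_distrib_left)
    finally show ?thesis .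
  qed
  have "x = (B * A) *\<^sub>v x"
    using BA x by simp
  also have "\<dots> = B *\<^sub>v y"
    using A B x unfolding y_def by simp
  finally have xy: "x = B *\<^sub>v y" .
  have y: "y \<in> carrier_vec n"
    using A x by (simp add: y_def)
  have "N \<le> (\<Sum>i<n. \<Sum>j<n. \<bar>B $$ (i, j)\<bar> * (\<delta> * N))"
    unfolding N_def
  proof (rule sum_mono)
    fix i assume i: "i \<in> {..<n}"
    have "x $ i = (\<Sum>j<n. B $$ (i, j) * y $ j)"
      using i mult_mat_vec_index_sum[OF B y] by (subst xy) simp
    also have "\<bar>\<dots>\<bar> \<le> (\<Sum>j<n. \<bar>B $$ (i, j)\<bar> * (\<delta> * N))"
      using y_bound
      by (intro order_trans[OF sum_abs] sum_mono) (auto simp: abs_mult intro!: mult_left_mono)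
    finally show "\<bar>x $ i\<bar> \<le> (\<Sum>j<n. \<bar>B $$ (i, j)\<bar> * (\<delta> * (\<Sum>j<n. \<bar>x $ j\<bar>)))"
      by (simp only: N_def)
  qed
  then have "1 * N \<le> (\<delta> * (\<Sum>i<n. \<Sum>j<n. \<bar>B $$ (i, j)\<bar>)) * N"
    by (simp add: sum_distrib_left sum_distrib_right mult_ac)
  \<comment> \<open>The 1-norm of the nonzero vector \<open>x\<close> is positive and can be
    cancelled.\<close>
  moreover have "N > 0"
  proof -
    obtain j where "j < n" "x $ j \<noteq> 0"
      using x(1,2) by (metis carrier_vecD eq_vecI index_zero_vec)
    then show ?thesis
      unfolding N_def by (intro sum_pos2[of _ j]) auto
  qed
  ultimately show ?thesis
    by (simp only: mult_le_cancel_right_pos)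
qed

text \<open>With \<open>v = B *\<^sub>v s\<close>, both \<open>A\<close> and the subtracted rank-one
  matrix send \<open>v\<close> to \<open>s\<close>: the scalar is chosen to cancel
  \<open>s \<bullet> v\<close>. So \<open>v\<close> lies in the kernel of the difference.\<close>

lemma singular_rank_one_perturbation:
  fixes A :: "'a :: field mat"
  assumes A: "A \<in> carrier_mat n n" and B: "B \<in> carrier_mat n n" and AB: "A * B = 1\<^sub>m n"
    and s: "s \<in> carrier_vec n" and nz: "s \<bullet> (B *\<^sub>v s) \<noteq> 0"
  shows "\<not> invertible_mat (mat n n (\<lambda>(i, j). A $$ (i, j) - 1 / (s \<bullet> (B *\<^sub>v s)) * (s $ i * s $ j)))"
    (is "\<not> invertible_mat ?M")
proof -
  define v where "v = B *\<^sub>v s"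
  have v: "v \<in> carrier_vec n"
    using B s by (simp add: v_def)
  have "A *\<^sub>v v = (A * B) *\<^sub>v s"
    using A B s by (simp add: v_def)
  then have Av: "A *\<^sub>v v = s"
    using AB s by simp
  \<comment> \<open>A zero \<open>v\<close> would make the scalar product
    \<open>s \<bullet> v\<close> vanish.\<close>
  have "v \<noteq> 0\<^sub>v n"
    using nz s unfolding v_def by auto
  moreover have "?M *\<^sub>v v = 0\<^sub>v n"
  proof (rule eq_vecI)
    fix i assume "i < dim_vec (0\<^sub>v n)"
    then have i: "i < n"
      by simp
    have "(?M *\<^sub>v v) $ i = (A *\<^sub>v v) $ i - 1 / (s \<bullet> v) * s $ i * (s \<bullet> v)"
    proof -
      define c where "c = 1 / (s \<bullet> v)"
      have "(?M *\<^sub>v v) $ i = (\<Sum>j<n. (A $$ (i, j) - c * (s $ i * s $ j)) * v $ j)"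
        using i v by (subst mult_mat_vec_index_sum[of _ n n]) (auto simp: c_def v_def)
      also have "\<dots> = (\<Sum>j<n. A $$ (i, j) * v $ j) - c * s $ i * (\<Sum>j<n. s $ j * v $ j)"
        by (simp only: sum_subtractf left_diff_distrib sum_distrib_left mult.assoc)
      also have "\<dots> = (A *\<^sub>v v) $ i - c * s $ i * (s \<bullet> v)"
        using v by (simp add: mult_mat_vec_index_sum[OF A v i] scalar_prod_def lessThan_atLeast0)
      finally show ?thesis
        by (simp only: c_def)
    qed
    also have "\<dots> = 0"
      using nz by (simp add: Av v_def[symmetric])
    finally show "(?M *\<^sub>v v) $ i = 0\<^sub>v n $ i"
      using i by simp
  qed simp
  ultimately show ?thesis
    using v singular_iff_kernel[of ?M n] by auto
qed

section \<open>The interval matrix and the minimal radius\<close>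

text \<open>A matrix sum or difference takes its dimensions from the second operand, so
  \<open>ones_mat n\<close> fixes the shape of both bounds, and the order passes it on to
  \<open>M\<close>.\<close>

lemma mem_interval_ones_mat_iff:
  "M \<in> {A - \<delta> \<cdot>\<^sub>m ones_mat n .. A + \<delta> \<cdot>\<^sub>m ones_mat n} \<longleftrightarrow>
    M \<in> carrier_mat n n \<and> (\<forall>i<n. \<forall>j<n. \<bar>A $$ (i, j) - M $$ (i, j)\<bar> \<le> \<delta>)"
proof -
  have entry: "\<bar>A $$ (i, j) - M $$ (i, j)\<bar> \<le> \<delta> \<longleftrightarrow>
      A $$ (i, j) - \<delta> \<le> M $$ (i, j) \<and> M $$ (i, j) \<le> A $$ (i, j) + \<delta>" for i j
    by (simp only: abs_le_iff) linarith
  have lower: "A - \<delta> \<cdot>\<^sub>m ones_mat n \<le> M \<longleftrightarrow> M \<in> carrier_mat n n \<and>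
      (\<forall>i<n. \<forall>j<n. A $$ (i, j) - \<delta> \<le> M $$ (i, j))"
    unfolding less_eq_mat_def ones_mat_def by (rule iffI) auto
  have upper: "M \<le> A + \<delta> \<cdot>\<^sub>m ones_mat n \<longleftrightarrow> M \<in> carrier_mat n n \<and>
      (\<forall>i<n. \<forall>j<n. M $$ (i, j) \<le> A $$ (i, j) + \<delta>)"
    unfolding less_eq_mat_def ones_mat_def by (rule iffI) auto
  show ?thesis
    unfolding atLeastAtMost_iff lower upper entry by blast
qed

theorem mainTheorem7:
  fixes A :: "real mat" and n :: nat
  assumes "n \<ge> 1"
    and "A \<in> carrier_mat n n"
    and "totally_positive A"
  shows "regularity_radius A =
    1 / (sign_vec n \<bullet> (the (mat_inverse A) *\<^sub>v sign_vec n))"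
proof -
  note A = assms(2)
  have "det A \<noteq> 0"
    using totally_positive_det_pos[OF A assms(3,1)] by simp
  \<comment> \<open>This makes \<open>the (mat_inverse A)\<close> a genuine inverse rather than an
    unspecified value.\<close>
  then have "mat_inverse A \<noteq> None"
    using det_non_zero_imp_unit[OF A, of "()"] mat_inverse(1)[OF A, of "()"] by blast
  then obtain B where B': "mat_inverse A = Some B"
    by blast
  then have AB: "A * B = 1\<^sub>m n" and BA: "B * A = 1\<^sub>m n" and B: "B \<in> carrier_mat n n"
    using mat_inverse(2)[OF A] by auto
  define s where "s = sign_vec n"
  have s: "s \<in> carrier_vec n" "\<And>i. i < n \<Longrightarrow> s $ i = (-1) ^ i"
    by (auto simp: s_def sign_vec_def)
  define S where "S = (\<Sum>i<n. \<Sum>j<n. \<bar>B $$ (i, j)\<bar>)"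
  note checkerboard = totally_positive_inverse_checkerboard[OF A assms(3) B BA]
  have "s \<bullet> (B *\<^sub>v s) = (\<Sum>i<n. \<Sum>j<n. (-1) ^ (i + j) * B $$ (i, j))"
    using s B by (simp add: scalar_prod_def lessThan_atLeast0 sum_distrib_left power_add mult_ac)
  also have "\<dots> = S"
    unfolding S_def
  proof (intro sum.cong refl)
    fix i j assume "i \<in> {..<n}" "j \<in> {..<n}"
    then have "(-1) ^ (i + j) * B $$ (i, j) = \<bar>(-1) ^ (i + j) * B $$ (i, j)\<bar>"
      using checkerboard[of i j] by simp
    then show "(-1) ^ (i + j) * B $$ (i, j) = \<bar>B $$ (i, j)\<bar>"
      by (simp add: abs_mult power_abs)
  qed
  finally have sBs: "s \<bullet> (B *\<^sub>v s) = S" .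
  \<comment> \<open>Strict signs exclude zero entries; since \<open>n \<ge> 1\<close> the sum
    \<open>S\<close> is nonempty, hence positive.\<close>
  have "\<bar>B $$ (i, j)\<bar> > 0" if "i < n" "j < n" for i j
    using checkerboard[OF that] by auto
  then have S: "S > 0"
    unfolding S_def using assms(1) by (intro sum_pos) (auto simp: lessThan_empty_iff)
  have "regularity_radius A = 1 / S"
    unfolding regularity_radius_def carrier_matD(1)[OF A]
  proof (rule Least_equality)
    \<comment> \<open>The products \<open>s $ i * s $ j\<close> are 1 or -1, so every entry of
      \<open>A\<close> moves by exactly \<open>1 / S\<close> and \<open>M\<close> stays within that
      radius. It is singular because \<open>S\<close> equals
      \<open>s \<bullet> (B *\<^sub>v s)\<close>.\<close>
    define M where "M = mat n n (\<lambda>(i, j). A $$ (i, j) - 1 / S * (s $ i * s $ j))"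
    have "\<not> invertible_mat M"
      using singular_rank_one_perturbation[OF A B AB s(1)] S by (simp add: sBs M_def)
    moreover have "M \<in> {A - (1 / S) \<cdot>\<^sub>m ones_mat n .. A + (1 / S) \<cdot>\<^sub>m ones_mat n}"
      unfolding mem_interval_ones_mat_iff
      using S by (auto simp: M_def s(2) abs_mult power_abs)
    ultimately show "1 / S \<ge> 0 \<and>
        singular_set {A - (1 / S) \<cdot>\<^sub>m ones_mat n .. A + (1 / S) \<cdot>\<^sub>m ones_mat n}"
      using S unfolding singular_set_def by auto
  next
    \<comment> \<open>Minimality: a singular matrix within distance \<open>\<delta>\<close> forces
      \<open>\<delta> * S\<close> to be at least 1.\<close>
    fix \<delta> :: real
    assume "\<delta> \<ge> 0 \<and> singular_set {A - \<delta> \<cdot>\<^sub>m ones_mat n .. A + \<delta> \<cdot>\<^sub>m ones_mat n}"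
    then obtain M where "M \<in> carrier_mat n n" "\<not> invertible_mat M"
        "\<forall>i<n. \<forall>j<n. \<bar>A $$ (i, j) - M $$ (i, j)\<bar> \<le> \<delta>"
      unfolding singular_set_def using mem_interval_ones_mat_iff by blast
    then have "1 \<le> \<delta> * S"
      using singular_perturbation_lower_bound[OF A B BA] unfolding S_def by blast
    then show "1 / S \<le> \<delta>"
      using S by (simp add: divide_le_eq)
  qed
  then show ?thesis
    by (simp add: B' sBs flip: s_def)
qed

end
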